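(* Let $A$ be a finite alphabet, let $[w]$ be a circular word over $A$ and let $w$ be any linearization of $[w]$, with $w$ nonempty. Then $$\mathcal{M}_{[w]}=\mathcal{M}_{ww}\cap A^{\leq |w|}.$$
   Context: Words are elements of the free monoid $A^*$; $|w|$ is the length of $w$, $\varepsilon$ is the empty word, and $A^{\le m}$ is the set of words over $A$ of length at most $m$. A circular word $[w]$ is the conjugacy class of $w$ (the set of all rotations $vu$ of $w=uv$); any element of the class is a linearization of $[w]$. For a word $v$, $\mathcal{F}_v$ denotes the set of factors (contiguous subwords, including $\varepsilon$) of $v$. The set of factors of $[w]$ is $\mathcal{F}_{w^*}=\bigcup_{k\ge0}\mathcal{F}_{w^k}$; it does not depend on the linearization. For a language $L$ closed under taking factors, the set of minimal forbidden factors is $$\mathcal{M}_L=\{a\in A\mid a\notin L\}\cup\{aub\mid a,b\in A,\ u\in A^*,\ aub\notin L,\ au\in L,\ ub\in L\}.$$ For a word $v$, $\mathcal{M}_v:=\mathcal{M}_{\mathcal{F}_v}$; for a circular word, $\mathcal{M}_{[w]}:=\mathcal{M}_{\mathcal{F}_{w^*}}$. *)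

theory Defs
  imports Main "HOL-Library.Sublist"
begin

definition factors :: "'a list \<Rightarrow> 'a list set" where
  "factors v = {u. sublist u v}"

definition star_factors :: "'a list \<Rightarrow> 'a list set" where
  "star_factors w = (\<Union>k. factors (concat (replicate k w)))"

definition conj_class :: "'a list \<Rightarrow> 'a list set" where
  "conj_class w = {v @ u | u v. w = u @ v}"

definition circular_word_over :: "'a set \<Rightarrow> 'a list set \<Rightarrow> bool" where
  "circular_word_over A C \<longleftrightarrow> (\<exists>w \<in> lists A. C = conj_class w)"

text \<open>All linearizations have the same factors (\<open>star_factors_conj_class\<close> below), so
  taking the union over the class amounts to choosing any one of them; see
  \<open>circular_factors_eq\<close>.\<close>

definition circular_factors :: "'a list set \<Rightarrow> 'a list set" where
  "circular_factors C = (\<Union>w\<in>C. star_factors w)"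

text \<open>The alphabet is an explicit set rather than the whole type, since letters of the
  alphabet that do not occur in the language are themselves minimal forbidden factors.\<close>

definition min_forbidden :: "'a set \<Rightarrow> 'a list set \<Rightarrow> 'a list set" where
  "min_forbidden A L =
     {[a] | a. a \<in> A \<and> [a] \<notin> L} \<union>
     {a # u @ [b] | a u b. a \<in> A \<and> b \<in> A \<and> u \<in> lists A \<and>
        a # u @ [b] \<notin> L \<and> a # u \<in> L \<and> u @ [b] \<in> L}"

abbreviation min_forbidden_word :: "'a set \<Rightarrow> 'a list \<Rightarrow> 'a list set" where
  "min_forbidden_word A v \<equiv> min_forbidden A (factors v)"

abbreviation min_forbidden_circular :: "'a set \<Rightarrow> 'a list set \<Rightarrow> 'a list set" where
  "min_forbidden_circular A C \<equiv> min_forbidden A (circular_factors C)"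

definition words_upto :: "'a set \<Rightarrow> nat \<Rightarrow> 'a list set" where
  "words_upto A m = {u \<in> lists A. length u \<le> m}"

lemma concat_replicate_rotate:
  "u @ concat (replicate k (v @ u)) = concat (replicate k (u @ v)) @ u"
  by (induction k) simp_all

lemma star_factors_append_subset: "star_factors (v @ u) \<subseteq> star_factors (u @ v)"
proof
  fix x assume "x \<in> star_factors (v @ u)"
  then obtain k where x: "sublist x (concat (replicate k (v @ u)))"
    by (auto simp: star_factors_def factors_def)
  have "concat (replicate (Suc k) (u @ v)) = u @ concat (replicate k (v @ u)) @ v"
    using arg_cong[OF concat_replicate_rotate[of u k v], of "\<lambda>x. x @ v"]
      concat_replicate_rotate[of "u @ v" k "[]"] by simp
  then have "sublist (concat (replicate k (v @ u))) (concat (replicate (Suc k) (u @ v)))"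
    by (auto simp: sublist_def)
  with x have "sublist x (concat (replicate (Suc k) (u @ v)))"
    using sublist_order.order.trans by blast
  then show "x \<in> star_factors (u @ v)"
    unfolding star_factors_def factors_def by blast
qed

lemma star_factors_conj_class: "w' \<in> conj_class w \<Longrightarrow> star_factors w' = star_factors w"
  unfolding conj_class_def using star_factors_append_subset by blast

lemma circular_factors_eq: "circular_factors (conj_class w) = star_factors w"
proof -
  have "w \<in> conj_class w"
    unfolding conj_class_def by force
  then show ?thesis
    unfolding circular_factors_def using star_factors_conj_class by blast
qed

end

theory Submission
  imports Defs "HOL-Library.Multiset"
begin

text \<open>Put \<open>n = length w\<close>. Every factor of a power of \<open>w\<close> of length at most \<open>n + 1\<close> already occurs
  in \<open>w @ w\<close>, so both sides have the same words of length at most \<open>n\<close>, and it remains to see that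
  a minimal forbidden factor \<open>a # u @ [b]\<close> of the circular word has length at most \<open>n\<close>.
  Otherwise \<open>a # u\<close> and \<open>u @ [b]\<close> have length at least \<open>n\<close> and both have period \<open>n\<close>. If
  \<open>length u \<ge> n\<close>, then the periodicity of \<open>u @ [b]\<close> makes \<open>b\<close> the periodic continuation of
  \<open>a # u\<close>. If \<open>length u = n - 1\<close>, then \<open>a # u\<close> and \<open>u @ [b]\<close> are conjugates of \<open>w\<close>, so they have
  the same letters with multiplicity, whence \<open>a = b\<close>, again the periodic continuation. In both
  cases \<open>a # u @ [b]\<close> is a factor of a power of \<open>w\<close>.\<close>

lemma sublist_iff_nth:
  "sublist x y \<longleftrightarrow> (\<exists>i. i + length x \<le> length y \<and> (\<forall>j<length x. x ! j = y ! (i + j)))"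
proof
  assume "sublist x y"
  then obtain p s where "y = p @ x @ s"
    by (auto simp: sublist_def)
  then show "\<exists>i. i + length x \<le> length y \<and> (\<forall>j<length x. x ! j = y ! (i + j))"
    by (intro exI[of _ "length p"]) (auto simp: nth_append)
next
  assume "\<exists>i. i + length x \<le> length y \<and> (\<forall>j<length x. x ! j = y ! (i + j))"
  then obtain i where "i + length x \<le> length y" "\<And>j. j < length x \<Longrightarrow> x ! j = y ! (i + j)"
    by blast
  then have "x = take (length x) (drop i y)"
    by (intro nth_equalityI) auto
  then show "sublist x y"
    by (metis sublist_drop sublist_order.order.trans sublist_take)
qed

lemma length_concat_replicate: "length (concat (replicate k w)) = k * length w"
  by (induction k) simp_all

lemma nth_concat_replicate:
  "t < k * length w \<Longrightarrow> concat (replicate k w) ! t = w ! (t mod length w)"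
  by (induction k arbitrary: t) (auto simp: nth_append le_mod_geq)

text \<open>Factors of powers of \<open>w\<close> are windows of the infinite periodic word with
  period \<open>w\<close>; reading indices modulo \<open>length w\<close> eliminates the
  exponent.\<close>

lemma star_factors_iff_nth:
  assumes "w \<noteq> []"
  shows "x \<in> star_factors w \<longleftrightarrow> (\<exists>i. \<forall>j<length x. x ! j = w ! ((i + j) mod length w))"
proof
  assume "x \<in> star_factors w"
  then obtain k i where "i + length x \<le> k * length w"
    "\<forall>j<length x. x ! j = concat (replicate k w) ! (i + j)"
    by (auto simp: star_factors_def factors_def sublist_iff_nth length_concat_replicate)
  then show "\<exists>i. \<forall>j<length x. x ! j = w ! ((i + j) mod length w)"
    by (intro exI[of _ i]) (auto simp: nth_concat_replicate)
next
  assume "\<exists>i. \<forall>j<length x. x ! j = w ! ((i + j) mod length w)"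
  then obtain i where i: "\<And>j. j < length x \<Longrightarrow> x ! j = w ! ((i + j) mod length w)"
    by blast
  \<comment> \<open>As \<open>length w\<close> is at least 1, this many copies of \<open>w\<close>
    cover the window.\<close>
  define k where "k = i + length x"
  have k: "i + length x \<le> k * length w"
    using assms by (simp add: k_def Suc_le_eq)
  then have "x ! j = concat (replicate k w) ! (i + j)" if "j < length x" for j
    using that i[OF that] by (simp add: nth_concat_replicate)
  with k have "sublist x (concat (replicate k w))"
    by (auto simp: sublist_iff_nth length_concat_replicate)
  then show "x \<in> star_factors w"
    by (auto simp: star_factors_def factors_def)
qed

lemma factors_square_iff_star_factors:
  assumes "w \<noteq> []" "length x \<le> Suc (length w)"
  shows "x \<in> factors (w @ w) \<longleftrightarrow> x \<in> star_factors w"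
proof
  assume "x \<in> factors (w @ w)"
  moreover have "concat (replicate 2 w) = w @ w"
    by (simp add: numeral_2_eq_2)
  ultimately show "x \<in> star_factors w"
    unfolding star_factors_def by (metis UN_I UNIV_I)
next
  assume "x \<in> star_factors w"
  then obtain i where i: "\<And>j. j < length x \<Longrightarrow> x ! j = w ! ((i + j) mod length w)"
    using star_factors_iff_nth[OF assms(1)] by blast
  \<comment> \<open>By periodicity the window may start inside the first copy of \<open>w\<close>,
    at index at most \<open>length w - 1\<close>; two copies then leave room for
    \<open>length w + 1\<close> letters.\<close>
  define i' where "i' = i mod length w"
  have "i' < length w"
    using assms(1) by (simp add: i'_def)
  then have bound: "i' + length x \<le> 2 * length w"
    using assms(2) by linarith
  have "x ! j = concat (replicate 2 w) ! (i' + j)" if "j < length x" for j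
  proof -
    have "i' + j < 2 * length w"
      using that bound by linarith
    then show ?thesis
      using i[OF that] by (simp only: nth_concat_replicate) (simp add: i'_def mod_add_left_eq)
  qed
  with bound have "sublist x (concat (replicate 2 w))"
    unfolding sublist_iff_nth length_concat_replicate by blast
  then show "x \<in> factors (w @ w)"
    by (simp add: factors_def numeral_2_eq_2)
qed

text \<open>A window of exactly one period is a rotation of \<open>w\<close>.\<close>

lemma mset_star_factor:
  assumes "w \<noteq> []" "x \<in> star_factors w" "length x = length w"
  shows "mset x = mset w"
proof -
  obtain i where "\<And>j. j < length x \<Longrightarrow> x ! j = w ! ((i + j) mod length w)"
    using assms(2) star_factors_iff_nth[OF assms(1)] by blast
  then have "x = rotate i w"
    using assms(3) by (intro nth_equalityI) (simp_all add: nth_rotate)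
  then show ?thesis
    by (metis rotate_drop_take append_take_drop_id mset_append union_commute)
qed

lemma star_factors_overlap:
  assumes "w \<noteq> []" and au: "a # u \<in> star_factors w" and ub: "u @ [b] \<in> star_factors w"
    and len: "length w \<le> Suc (length u)"
  shows "a # u @ [b] \<in> star_factors w"
proof -
  let ?n = "length w"
  obtain i where i: "\<And>j. j < Suc (length u) \<Longrightarrow> (a # u) ! j = w ! ((i + j) mod ?n)"
    using au star_factors_iff_nth[OF assms(1)] by auto
  obtain i' where i': "\<And>j. j < Suc (length u) \<Longrightarrow> (u @ [b]) ! j = w ! ((i' + j) mod ?n)"
    using ub star_factors_iff_nth[OF assms(1)] by auto
  \<comment> \<open>In \<open>a # u @ [b]\<close> the letter \<open>b\<close> has index
    \<open>Suc (length u)\<close>; the index used here lies one period earlier.\<close>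
  have "b = (a # u) ! (Suc (length u) - ?n)"
  proof (cases "?n = Suc (length u)")
    case True
    \<comment> \<open>Cancelling the letters of \<open>u\<close> leaves \<open>a = b\<close>, and
      the index is 0.\<close>
    have "mset (a # u) = mset (u @ [b])"
      using mset_star_factor[OF assms(1) au] mset_star_factor[OF assms(1) ub] True by simp
    then show ?thesis
      using True by simp
  next
    case False
    with len have le: "?n \<le> length u"
      by simp
    \<comment> \<open>Strictness places this index inside \<open>u\<close>, before the final
      \<open>b\<close>.\<close>
    with assms(1) have less: "length u - ?n < length u"
      by (intro diff_less) auto
    have "b = w ! ((i' + length u) mod ?n)"
      using i'[of "length u"] by simp
    also have "i' + length u = i' + (length u - ?n) + ?n"
      using le by simp
    also have "w ! ((i' + (length u - ?n) + ?n) mod ?n) = (u @ [b]) ! (length u - ?n)"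
      using i'[of "length u - ?n"] by simp
    also have "\<dots> = (a # u) ! (Suc (length u) - ?n)"
      using le less by (simp add: nth_append Suc_diff_le)
    finally show ?thesis .
  qed
  also have "\<dots> = w ! ((i + (Suc (length u) - ?n)) mod ?n)"
    using assms(1) by (intro i) simp
  also have "\<dots> = w ! ((i + (Suc (length u) - ?n) + ?n) mod ?n)"
    by simp
  also have "i + (Suc (length u) - ?n) + ?n = i + Suc (length u)"
    using len by simp
  finally have b: "b = w ! ((i + Suc (length u)) mod ?n)" .
  have "(a # u @ [b]) ! j = w ! ((i + j) mod ?n)" if "j < length (a # u @ [b])" for j
  proof (cases "j = Suc (length u)")
    case True
    with b show ?thesis by simp
  next
    case False
    with that have "j < Suc (length u)" by simp
    then show ?thesis
      using i[of j] nth_append[of "a # u" "[b]" j] by simp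
  qed
  then show ?thesis
    using star_factors_iff_nth[OF assms(1)] by blast
qed

text \<open>Only \<open>x\<close> itself and \<open>x\<close> without its first or its last letter
  are tested for membership, and none of these is longer than \<open>x\<close>.\<close>

lemma min_forbidden_cong:
  assumes "\<And>y. length y \<le> length x \<Longrightarrow> y \<in> L \<longleftrightarrow> y \<in> L'"
  shows "x \<in> min_forbidden A L \<longleftrightarrow> x \<in> min_forbidden A L'"
  using assms by (fastforce simp: min_forbidden_def)

lemma min_forbidden_subset_lists: "min_forbidden A L \<subseteq> lists A"
  by (auto simp: min_forbidden_def)

lemma length_min_forbidden_star_factors:
  assumes "w \<noteq> []" "x \<in> min_forbidden A (star_factors w)"
  shows "length x \<le> length w"
proof -
  \<comment> \<open>This settles the one-letter words; for \<open>a # u @ [b]\<close> longer than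
    \<open>w\<close>, \<open>star_factors_overlap\<close> gives a contradiction.\<close>
  have "length w > 0"
    using assms(1) by simp
  then show ?thesis
    using assms(2) star_factors_overlap[OF assms(1)]
    by (force simp: min_forbidden_def not_le Suc_le_eq)
qed

theorem lemma2:
  fixes A :: "'a set" and C :: "'a list set" and w :: "'a list"
  assumes "finite A"
    and "circular_word_over A C"
    and "w \<in> C"
    and "w \<noteq> []"
  shows "min_forbidden_circular A C = min_forbidden_word A (w @ w) \<inter> words_upto A (length w)"
proof -
  have C: "circular_factors C = star_factors w"
    using assms(2,3) circular_factors_eq star_factors_conj_class
    by (metis circular_word_over_def)
  have "x \<in> min_forbidden A (star_factors w) \<longleftrightarrow> x \<in> min_forbidden_word A (w @ w)"
    if "length x \<le> length w" for x
    using that by (intro min_forbidden_cong) (simp add: factors_square_iff_star_factors assms(4))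
  then show ?thesis
    using length_min_forbidden_star_factors[OF assms(4)] min_forbidden_subset_lists
    unfolding C words_upto_def by blast
qed

end
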